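(* Let $a,b\in\mathbb{C}$ with $|a|^2+|b|^2=1$, let $x\ge 1$ be an odd integer (so that $x-1$ is even), and consider a chain of $x+1$ copies of $|\eta\rangle=a|00\rangle+b|11\rangle$. Let $|A_{x-1}\rangle$ be the random two-qubit output state after $x-1$ successive entanglement swaps (which use up the first $x$ copies), one further copy of $|\eta\rangle$ remaining. Suppose that $|A_{x-1}\rangle$ is distributed as follows: for each integer $n$ with $0\le n\le \frac{x-1}{2}$, $$|A_{x-1}\rangle=|\eta_{x-2n}\rangle\ \text{ with probability }\ \binom{x}{n}|a|^{2x-2n}|b|^{2n}+\binom{x}{x-n}|a|^{2n}|b|^{2x-2n}.$$ Then the output $|A_x\rangle$ of the next swap, $|A_x\rangle=S(|A_{x-1}\rangle\otimes|\eta\rangle)$, is distributed as follows: for each integer $n$ with $0\le n<\frac{x+1}{2}$, $$|A_x\rangle=|\eta_{x+1-2n}\rangle\ \text{ with probability }\ \binom{x+1}{n}\left(|a|^{2(x+1)-2n}|b|^{2n}+|a|^{2n}|b|^{2(x+1)-2n}\right),$$ and $$|A_x\rangle=|\eta_0\rangle\ \text{ with probability }\ \binom{x+1}{\frac{x+1}{2}}|a|^{x+1}|b|^{x+1}.$$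
   Context: For $m\in\{0,1,2,\dots\}$ put $n_m=\sqrt{|a|^{2m}+|b|^{2m}}$ (with $0^0=1$) and $|\eta_m\rangle=\frac{a^m|00\rangle+b^m|11\rangle}{n_m}$, so $|\eta_1\rangle=|\eta\rangle$ and $|\eta_0\rangle=(|00\rangle+|11\rangle)/\sqrt2$. States are identified when they agree up to a global phase. The entanglement swap map $S$ acts on $|\eta_m\rangle\otimes|\eta_p\rangle$ with $m\ge p$ (qubits 1,2 carry $|\eta_m\rangle$, qubits 3,4 carry $|\eta_p\rangle$) as follows: apply CNOT with control qubit 2 and target qubit 3; apply a Hadamard gate to qubit 2; measure qubits 2 and 3 in the computational basis, with outcomes $s,t\in\{0,1\}$; apply $Z^s$ to qubit 1 and $X^t$ to qubit 4. The output is the resulting (random) state of qubits 1 and 4. The outcomes $s,t$ are not recorded, so the output of $S$ is a random pure two-qubit state, described by listing the possible states with their probabilities; these labels are formal, i.e. the probability attached to label $|\eta_k\rangle$ is the total probability of the measurement outcomes giving index $k$ (outcome $t=0$ gives index $m+p$, outcome $t=1$ gives index $m-p$). When $S$ is applied to a random state $|A\rangle\otimes|\eta\rangle$, the output is obtained by first sampling $|A\rangle$ and then performing the swap with independent measurement randomness. In the chain, $|A_0\rangle=|\eta\rangle$ and $|A_{k}\rangle=S(|A_{k-1}\rangle\otimes|\eta\rangle)$. *)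

theory Defs
  imports "HOL-Probability.Probability"
begin

text \<open>
  Qubit basis labels are booleans, with \<open>False\<close> for 0 and \<open>True\<close> for 1. State vectors are
  vectors over \<open>complex\<close>, whose library norm is the Euclidean one. In a four-qubit index
  \<open>(q1, (q2, q3), q4)\<close> the qubits 2 and 3, on which the swap operates, are grouped together.
\<close>

type_synonym ket2 = "complex ^ (bool \<times> bool)"
type_synonym ket4 = "complex ^ (bool \<times> (bool \<times> bool) \<times> bool)"

definition kron :: "complex ^ 'a ^ 'b \<Rightarrow> complex ^ 'c ^ 'd \<Rightarrow> complex ^ ('a \<times> 'c) ^ ('b \<times> 'd)" where
  "kron A B = (\<chi> i j. A $ fst i $ fst j * B $ snd i $ snd j)"

definition hadamard :: "complex ^ bool ^ bool" where
  "hadamard = (\<chi> i j. (if i \<and> j then -1 else 1) / complex_of_real (sqrt 2))"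

definition pauli_X :: "complex ^ bool ^ bool" where
  "pauli_X = (\<chi> i j. if i \<noteq> j then 1 else 0)"

definition pauli_Z :: "complex ^ bool ^ bool" where
  "pauli_Z = (\<chi> i j. if i = j then (if i then -1 else 1) else 0)"

text \<open>The control is the first component; on booleans, \<open>\<noteq>\<close> is addition modulo 2.\<close>

definition cnot :: "complex ^ (bool \<times> bool) ^ (bool \<times> bool)" where
  "cnot = (\<chi> i j. if i = (fst j, fst j \<noteq> snd j) then 1 else 0)"

definition tensor :: "ket2 \<Rightarrow> ket2 \<Rightarrow> ket4" where
  "tensor \<psi> \<phi> = vec_lambda (\<lambda>(q1, (q2, q3), q4). \<psi> $ (q1, q2) * \<phi> $ (q3, q4))"

definition pre_measurement :: "ket2 \<Rightarrow> ket2 \<Rightarrow> ket4" where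
  "pre_measurement \<psi> \<phi> =
     kron (mat 1) (kron (kron hadamard (mat 1)) (mat 1)) *v
       (kron (mat 1) (kron cnot (mat 1)) *v tensor \<psi> \<phi>)"

text \<open>The unnormalised state of qubits 1 and 4 for the outcome \<open>(s, t)\<close> on qubits 2 and 3.\<close>

definition branch :: "ket2 \<Rightarrow> ket2 \<Rightarrow> bool \<times> bool \<Rightarrow> ket2" where
  "branch \<psi> \<phi> st = vec_lambda (\<lambda>(q1, q4). pre_measurement \<psi> \<phi> $ (q1, st, q4))"

text \<open>
  The Born rule. The squared norms add up to 1, as \<^const>\<open>embed_pmf\<close> requires, whenever
  \<open>\<psi>\<close> and \<open>\<phi>\<close> are unit vectors.
\<close>

definition outcome_pmf :: "ket2 \<Rightarrow> ket2 \<Rightarrow> (bool \<times> bool) pmf" where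
  "outcome_pmf \<psi> \<phi> = embed_pmf (\<lambda>st. (norm (branch \<psi> \<phi> st))\<^sup>2)"

definition corrected :: "ket2 \<Rightarrow> ket2 \<Rightarrow> bool \<times> bool \<Rightarrow> ket2" where
  "corrected \<psi> \<phi> = (\<lambda>(s, t).
     kron (if s then pauli_Z else mat 1) (if t then pauli_X else mat 1) *v
       (branch \<psi> \<phi> (s, t) /\<^sub>R norm (branch \<psi> \<phi> (s, t))))"

definition eta :: "complex \<Rightarrow> complex \<Rightarrow> nat \<Rightarrow> ket2" where
  "eta a b m = vec_lambda (\<lambda>(q, r).
     (if q = r then (if q then b ^ m else a ^ m) else 0)
       / complex_of_real (sqrt (cmod a ^ (2 * m) + cmod b ^ (2 * m))))"

text \<open>
  A random state is a distribution on pairs of a formal index and an actual state vector. The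
  index is carried along because different indices may name the same state (for instance all
  of them do if \<open>a = b\<close>), and probabilities are attached to indices. That the vector
  really is the state named by the index is part of \<open>has_prob\<close> below.
\<close>

type_synonym labelled_state = "nat \<times> ket2"

definition swap_ordered :: "labelled_state \<Rightarrow> labelled_state \<Rightarrow> labelled_state pmf" where
  "swap_ordered = (\<lambda>(m, \<psi>) (p, \<phi>).
     map_pmf (\<lambda>(s, t). (if t then m - p else m + p, corrected \<psi> \<phi> (s, t))) (outcome_pmf \<psi> \<phi>))"

text \<open>
  The swap requires the index on qubits 1 and 2 to be at least the one on qubits 3 and 4, so
  the pair with the larger index is placed first. In a chain this reorders only
  the case of index 0 against index 1.
\<close>

definition entanglement_swap :: "labelled_state \<Rightarrow> labelled_state \<Rightarrow> labelled_state pmf" where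
  "entanglement_swap \<alpha> \<beta> = (if fst \<beta> \<le> fst \<alpha> then swap_ordered \<alpha> \<beta> else swap_ordered \<beta> \<alpha>)"

primrec swap_chain :: "complex \<Rightarrow> complex \<Rightarrow> nat \<Rightarrow> labelled_state pmf" where
  "swap_chain a b 0 = return_pmf (1, eta a b 1)"
| "swap_chain a b (Suc k) = bind_pmf (swap_chain a b k) (\<lambda>\<alpha>. entanglement_swap \<alpha> (1, eta a b 1))"

definition same_up_to_phase :: "ket2 \<Rightarrow> ket2 \<Rightarrow> bool" where
  "same_up_to_phase \<psi> \<phi> \<longleftrightarrow> (\<exists>c. cmod c = 1 \<and> \<psi> = c *s \<phi>)"

text \<open>
  The random state \<open>A\<close> equals \<open>eta a b k\<close> with probability \<open>P\<close>: the index \<open>k\<close> has total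
  probability \<open>P\<close>, and every vector that occurs with index \<open>k\<close> is \<open>eta a b k\<close> up to phase.
\<close>

definition has_prob :: "complex \<Rightarrow> complex \<Rightarrow> labelled_state pmf \<Rightarrow> nat \<Rightarrow> real \<Rightarrow> bool" where
  "has_prob a b A k P \<longleftrightarrow>
     measure_pmf.prob A {\<alpha>. fst \<alpha> = k} = P \<and>
     (\<forall>\<alpha> \<in> set_pmf A. fst \<alpha> = k \<longrightarrow> same_up_to_phase (snd \<alpha>) (eta a b k))"

end

theory Submission
  imports Defs
begin

text \<open>
  Write \<open>w m = |a|^(2m) + |b|^(2m)\<close>. On the outcome \<open>t = 0\<close> (resp. \<open>t = 1\<close>) a swap of
  \<open>eta m\<close> with \<open>eta 1\<close> produces, after correction, a scalar multiple of \<open>eta (m + 1)\<close> (resp.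
  \<open>eta (m - 1)\<close>); the squared modulus of that scalar is the probability of the outcome. Summed over
  \<open>s\<close> this gives \<open>w (m + 1) / w m\<close> and \<open>|ab|^2 w (m - 1) / w m\<close>. After an even number of
  swaps only odd indices occur, so the index moves up or down by one, and since the index
  \<open>x - 2n\<close> has probability \<open>(x choose n) |ab|^(2n) w (x - 2n)\<close>, the factors \<open>w\<close> cancel and the
  claim is Pascal's rule. Index 0 is reached only from index 1, where \<open>w 0 = 2\<close>.
\<close>

section \<open>Total probability, norms and finite sums\<close>

lemma measure_bind_pmf:
  "measure_pmf.prob (bind_pmf M f) X = (\<integral>x. measure_pmf.prob (f x) X \<partial>measure_pmf M)"
  unfolding measure_pmf_bind
  by (intro measure_pmf.measure_bind[where N = "count_space UNIV"])
     (auto simp: space_subprob_algebra intro: prob_space_imp_subprob_space measure_pmf.prob_space_axioms)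

lemma norm_ket2: "(norm (v :: ket2))\<^sup>2 = (\<Sum>q\<in>UNIV. \<Sum>r\<in>UNIV. (cmod (v $ (q, r)))\<^sup>2)"
  by (simp add: norm_vec_def L2_set_def sum_nonneg sum.cartesian_product case_prod_unfold)

lemma ket2_eqI:
  fixes v w :: ket2
  assumes "\<And>q r. v $ (q, r) = w $ (q, r)"
  shows "v = w"
  using assms by (auto simp: vec_eq_iff)

lemma norm_smult: "norm (c *s v) = cmod c * norm (v :: ket2)"
proof -
  have "(norm (c *s v))\<^sup>2 = (cmod c * norm v)\<^sup>2"
    by (simp add: norm_ket2 norm_mult power_mult_distrib sum_distrib_left)
  then show ?thesis
    by (simp add: power2_eq_iff_nonneg)
qed

lemma kron_mult_ket2:
  fixes A B :: "complex ^ bool ^ bool" and v :: ket2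
  shows "(kron A B *v v) $ (q, r) = (\<Sum>i\<in>UNIV. \<Sum>j\<in>UNIV. A $ q $ i * B $ r $ j * v $ (i, j))"
  by (simp add: matrix_vector_mult_def kron_def sum.cartesian_product case_prod_unfold)

lemma sum_UNIV_prod:
  "(\<Sum>z\<in>UNIV. f z) = (\<Sum>i\<in>UNIV. \<Sum>j\<in>UNIV. f (i :: 'i :: finite, j :: 'j :: finite))"
  by (simp add: sum.cartesian_product case_prod_unfold)

section \<open>The swap circuit in coordinates\<close>

text \<open>CNOT makes \<open>\<phi>\<close> be read at the sum of qubits 2 and 3 modulo 2. The
  Hadamard gate then adds the terms of both values of qubit 2, with a sign for \<open>s\<close> on
  the second.\<close>

lemma branch_nth:
  "branch \<psi> \<phi> (s, t) $ (q, r) =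
     (\<psi> $ (q, False) * \<phi> $ (t, r) + (if s then -1 else 1) * \<psi> $ (q, True) * \<phi> $ (\<not> t, r))
       / complex_of_real (sqrt 2)"
proof -
  have cn: "(kron (mat 1) (kron cnot (mat 1)) *v tensor \<psi> \<phi>) $ (q1, (q2, q3), q4)
      = \<psi> $ (q1, q2) * \<phi> $ (q2 \<noteq> q3, q4)" for q1 q2 q3 q4
    by (cases q1; cases q2; cases q3; cases q4)
       (simp_all add: matrix_vector_mult_def sum_UNIV_prod UNIV_bool kron_def mat_def cnot_def tensor_def)
  have hd: "(kron (mat 1) (kron (kron hadamard (mat 1)) (mat 1)) *v w) $ (q1, (q2, q3), q4)
      = (w $ (q1, (False, q3), q4) + (if q2 then -1 else 1) * w $ (q1, (True, q3), q4))
        / complex_of_real (sqrt 2)" for w :: ket4 and q1 q2 q3 q4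
    by (cases q1; cases q2; cases q3; cases q4)
       (simp_all add: matrix_vector_mult_def sum_UNIV_prod UNIV_bool kron_def mat_def hadamard_def
          field_simps)
  show ?thesis
    by (simp add: branch_def pre_measurement_def hd cn)
qed

text \<open>Carries a global phase through the swap. It is needed in the first argument, where the
  vector is known only up to phase.\<close>

lemma branch_smult: "branch (c *s \<psi>) \<phi> st = c *s branch \<psi> \<phi> st"
  by (cases st) (auto intro!: ket2_eqI simp: branch_nth field_simps)

text \<open>Kept apart from the normalisation in \<open>corrected\<close>, so that it can act on the
  unnormalised branch.\<close>

definition correction :: "bool \<times> bool \<Rightarrow> complex ^ (bool \<times> bool) ^ (bool \<times> bool)" where
  "correction = (\<lambda>(s, t). kron (if s then pauli_Z else mat 1) (if t then pauli_X else mat 1))"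

lemma corrected_eq: "corrected \<psi> \<phi> st = correction st *v (branch \<psi> \<phi> st /\<^sub>R norm (branch \<psi> \<phi> st))"
  by (cases st) (simp add: corrected_def correction_def)

lemma correction_nth:
  "(correction (s, t) *v v) $ (q, r) = (if s \<and> q then -1 else 1) * v $ (q, r \<noteq> t)"
  by (cases q; cases r; cases s; cases t)
     (simp_all add: correction_def kron_mult_ket2 UNIV_bool mat_def pauli_X_def pauli_Z_def)

text \<open>By \<open>correction_nth\<close> the correction permutes coordinates up to sign. Outcome
  probabilities can therefore be read off after correcting.\<close>

lemma norm_correction: "norm (correction st *v v) = norm v"
proof -
  have "(norm (correction st *v v))\<^sup>2 = (norm v)\<^sup>2"
    by (cases st; cases "snd st")
       (auto simp: norm_ket2 correction_nth UNIV_bool norm_mult power_mult_distrib)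
  then show ?thesis
    by (simp add: power2_eq_iff_nonneg)
qed

section \<open>Range and parity of the indices in a chain\<close>

text \<open>From index 0 the pair is reordered, and both outcomes give index 1, as 1 + 0 and 1 -
  0.\<close>

lemma fst_entanglement_swap:
  assumes "\<beta> \<in> set_pmf (entanglement_swap \<alpha> (1, \<phi>))"
  shows "fst \<beta> = fst \<alpha> + 1 \<or> fst \<beta> + 1 = fst \<alpha> \<or> fst \<alpha> = 0 \<and> fst \<beta> = 1"
  using assms
  by (cases \<alpha>) (auto simp: entanglement_swap_def swap_ordered_def split: if_splits)

text \<open>Each swap flips the parity of the index and raises it by at most 1, starting from index
  1.\<close>

lemma swap_chain_index:
  assumes "\<alpha> \<in> set_pmf (swap_chain a b k)"
  shows "fst \<alpha> \<le> k + 1 \<and> (even (fst \<alpha>) \<longleftrightarrow> odd k)"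
  using assms
proof (induction k arbitrary: \<alpha>)
  case (Suc k)
  then obtain \<gamma> where "\<gamma> \<in> set_pmf (swap_chain a b k)"
    and \<alpha>: "\<alpha> \<in> set_pmf (entanglement_swap \<gamma> (1, eta a b 1))"
    by auto
  with Suc.IH have \<gamma>: "fst \<gamma> \<le> k + 1" "even (fst \<gamma>) \<longleftrightarrow> odd k"
    by auto
  from fst_entanglement_swap[OF \<alpha>] show ?case
  proof (elim disjE)
    assume "fst \<alpha> + 1 = fst \<gamma>"
    with \<gamma> show ?thesis by (metis add_leD1 even_Suc le_SucI Suc_eq_plus1)
  qed (use \<gamma> in auto)
qed simp

section \<open>Swapping two states \<open>eta\<close> when \<open>a\<close> and \<open>b\<close> are
  normalised\<close>

context
  fixes a b :: complex
  assumes unit: "(cmod a)\<^sup>2 + (cmod b)\<^sup>2 = 1"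
begin

text \<open>The square of the normalising constant of \<open>eta a b m\<close>.\<close>

definition weight :: "nat \<Rightarrow> real" where
  "weight m = cmod a ^ (2 * m) + cmod b ^ (2 * m)"

lemma weight_pos: "weight m > 0"
proof -
  have "a \<noteq> 0 \<or> b \<noteq> 0"
    using unit by auto
  then show ?thesis
    unfolding weight_def by (auto intro: add_pos_nonneg add_nonneg_pos)
qed

lemma weight_1: "weight (Suc 0) = 1"
  using unit by (simp add: weight_def)

text \<open>Expanding the product, the pure powers of \<open>a\<close> and of \<open>b\<close> form
  \<open>weight (m + p)\<close>, and the mixed terms share the factor
  \<open>cmod (a * b) ^ (2 * p)\<close>. This makes the outcome probabilities add up to 1.\<close>

lemma weight_mult:
  assumes "p \<le> m"
  shows "weight (m + p) + cmod (a * b) ^ (2 * p) * weight (m - p) = weight m * weight p"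
proof -
  obtain d where "m = p + d"
    using assms le_Suc_ex by blast
  then show ?thesis
    by (simp add: weight_def norm_mult power_mult_distrib power_add algebra_simps)
       (simp add: algebra_simps flip: power_add)
qed

lemma eta_nth:
  "eta a b m $ (q, r) =
     (if q = r then (if q then b ^ m else a ^ m) else 0) / complex_of_real (sqrt (weight m))"
  by (simp add: eta_def weight_def)

lemma norm_eta: "norm (eta a b m) = 1"
proof -
  have "(norm (eta a b m))\<^sup>2 = 1"
    using weight_pos[of m]
    by (simp add: norm_ket2 eta_nth UNIV_bool norm_divide norm_power power_divide
        flip: add_divide_distrib power_mult)
       (simp add: weight_def mult.commute)
  then show ?thesis
    by (simp add: power2_eq_1_iff) (metis norm_ge_zero not_one_le_zero neg_0_le_iff_le)
qed

text \<open>The factor in front of the normalised output. It is independent of \<open>s\<close>,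
  whose sign the Z correction removes; \<open>sqrt 2\<close> comes from the Hadamard gate.\<close>

definition amplitude :: "nat \<Rightarrow> nat \<Rightarrow> bool \<Rightarrow> complex" where
  "amplitude m p t =
     (if t then (a * b) ^ p * complex_of_real (sqrt (weight (m - p)))
      else complex_of_real (sqrt (weight (m + p))))
       / complex_of_real (sqrt 2 * sqrt (weight m) * sqrt (weight p))"

text \<open>For \<open>t = False\<close> the surviving coefficients are \<open>a ^ (m + p)\<close>
  and, up to sign, \<open>b ^ (m + p)\<close>. For \<open>t = True\<close> they are
  \<open>a ^ m * b ^ p\<close> and \<open>b ^ m * a ^ p\<close> off the diagonal; X moves them onto
  it, and \<open>(a * b) ^ p\<close> factors out because \<open>p \<le> m\<close>.\<close>

lemma correction_branch_eta:
  assumes "p \<le> m"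
  shows "correction (s, t) *v branch (eta a b m) (eta a b p) (s, t) =
    amplitude m p t *s eta a b (if t then m - p else m + p)"
proof -
  obtain d where d: "m = p + d"
    using assms le_Suc_ex by blast
  have w: "weight k \<noteq> 0" for k
    using weight_pos[of k] by simp
  have "(correction (s, t) *v branch (eta a b m) (eta a b p) (s, t)) $ (q, r) =
      (amplitude m p t *s eta a b (if t then m - p else m + p)) $ (q, r)" for q r
    by (cases s; cases t; cases q; cases r)
       (simp_all add: correction_nth branch_nth eta_nth amplitude_def w d power_add power_mult_distrib mult_ac)
  then show ?thesis
    by (rule ket2_eqI)
qed

lemma norm_branch_eta:
  assumes "p \<le> m" "cmod c = 1"
  shows "norm (branch (c *s eta a b m) (eta a b p) (s, t)) = cmod (amplitude m p t)"
proof -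
  have "norm (branch (c *s eta a b m) (eta a b p) (s, t))
      = norm (correction (s, t) *v branch (eta a b m) (eta a b p) (s, t))"
    by (simp add: branch_smult norm_smult norm_correction assms)
  also have "\<dots> = cmod (amplitude m p t)"
    by (simp only: correction_branch_eta[OF assms(1)] norm_smult norm_eta)
  finally show ?thesis .
qed

text \<open>Normalising divides by the modulus of the amplitude, so only its phase times
  \<open>c\<close> remains. A zero amplitude, possible when \<open>a * b = 0\<close>, must be
  excluded.\<close>

lemma same_up_to_phase_corrected:
  assumes "p \<le> m" "cmod c = 1" "amplitude m p t \<noteq> 0"
  shows "same_up_to_phase (corrected (c *s eta a b m) (eta a b p) (s, t))
    (eta a b (if t then m - p else m + p))"
proof -
  let ?K = "amplitude m p t" and ?e = "eta a b (if t then m - p else m + p)"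
  have "corrected (c *s eta a b m) (eta a b p) (s, t)
      = correction (s, t) *v ((c / of_real (cmod ?K)) *s branch (eta a b m) (eta a b p) (s, t))"
    unfolding corrected_eq norm_branch_eta[OF assms(1,2)]
    by (rule arg_cong[of _ _ "(*v) _"])
       (simp add: branch_smult vec_eq_iff vector_scaleR_component scaleR_conv_of_real[where 'a = complex] field_simps)
  also have "\<dots> = (c * ?K / of_real (cmod ?K)) *s ?e"
    by (simp add: vector_scalar_commute correction_branch_eta[OF assms(1)])
  finally show ?thesis
    unfolding same_up_to_phase_def using assms(2,3)
    by (intro exI[of _ "c * ?K / of_real (cmod ?K)"]) (simp add: norm_mult norm_divide)
qed

lemma cmod_amplitude:
  "(cmod (amplitude m p t))\<^sup>2 =
     (if t then cmod (a * b) ^ (2 * p) * weight (m - p) else weight (m + p)) / (2 * weight m * weight p)"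
  using weight_pos
  by (simp add: amplitude_def norm_mult norm_divide norm_power power_mult_distrib power_divide
      less_imp_le mult.commute[of _ 2] flip: power_mult)

lemma pmf_outcome:
  assumes "p \<le> m" "cmod c = 1"
  shows "pmf (outcome_pmf (c *s eta a b m) (eta a b p)) (s, t) = (cmod (amplitude m p t))\<^sup>2"
proof -
  let ?f = "\<lambda>st. (norm (branch (c *s eta a b m) (eta a b p) st))\<^sup>2"
  have f: "?f (s, t) = (cmod (amplitude m p t))\<^sup>2" for s t
    using norm_branch_eta[OF assms] by simp
  \<comment> \<open>Both values of \<open>s\<close> contribute equally, cancelling the 2 in
    \<open>cmod_amplitude\<close>; \<open>weight_mult\<close> does the rest. This discharges the
    side condition of \<open>embed_pmf\<close>.\<close>
  have "(\<Sum>st\<in>UNIV. ?f st) = 1"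
    unfolding sum_UNIV_prod f
    using weight_mult[OF assms(1)] weight_pos[of m] weight_pos[of p]
    by (simp add: UNIV_bool cmod_amplitude field_simps)
  then have "(\<integral>\<^sup>+st. ennreal (?f st) \<partial>count_space UNIV) = 1"
    by (simp add: nn_integral_count_space_finite sum_ennreal)
  then have "pmf (outcome_pmf (c *s eta a b m) (eta a b p)) (s, t) = ?f (s, t)"
    unfolding outcome_pmf_def by (intro pmf_embed_pmf) auto
  with f show ?thesis by simp
qed

lemma swap_eta:
  assumes "1 \<le> m" "same_up_to_phase \<psi> (eta a b m)"
  defines "Q \<equiv> entanglement_swap (m, \<psi>) (1, eta a b 1)"
  shows prob_swap_add: "measure_pmf.prob Q {\<beta>. fst \<beta> = m + 1} = weight (m + 1) / weight m"
    and prob_swap_diff: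
      "measure_pmf.prob Q {\<beta>. fst \<beta> = m - 1} = cmod (a * b) ^ 2 * weight (m - 1) / weight m"
    and set_pmf_swap: "\<forall>\<beta>\<in>set_pmf Q. same_up_to_phase (snd \<beta>) (eta a b (fst \<beta>))"
proof -
  obtain c where c: "cmod c = 1" "\<psi> = c *s eta a b m"
    using assms(2) unfolding same_up_to_phase_def by blast
  let ?O = "outcome_pmf \<psi> (eta a b 1)"
  have Q: "Q = map_pmf (\<lambda>(s, t). (if t then m - 1 else m + 1, corrected \<psi> (eta a b 1) (s, t))) ?O"
    using assms(1) by (simp add: Q_def entanglement_swap_def swap_ordered_def del: One_nat_def)
  have pO: "pmf ?O (s, t) = (cmod (amplitude m 1 t))\<^sup>2" for s t
    using pmf_outcome[OF assms(1) c(1)] c(2) by simp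
  have prob: "measure_pmf.prob Q {\<beta>. fst \<beta> = (if t then m - 1 else m + 1)}
      = 2 * (cmod (amplitude m 1 t))\<^sup>2" for t
  proof -
    \<comment> \<open>The index reveals \<open>t\<close> but not \<open>s\<close>, so the event
      consists of two outcomes.\<close>
    have "measure_pmf.prob Q {\<beta>. fst \<beta> = (if t then m - 1 else m + 1)}
        = measure_pmf.prob ?O {(False, t), (True, t)}"
      using assms(1) unfolding Q measure_map_pmf
      by (intro arg_cong2[where f = measure]) (auto split: if_splits)
    also have "\<dots> = 2 * (cmod (amplitude m 1 t))\<^sup>2"
      by (simp add: measure_measure_pmf_finite pO del: One_nat_def)
    finally show ?thesis .
  qed
  show "measure_pmf.prob Q {\<beta>. fst \<beta> = m + 1} = weight (m + 1) / weight m"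
    using prob[of False] by (simp add: cmod_amplitude weight_1)
  show "measure_pmf.prob Q {\<beta>. fst \<beta> = m - 1} = cmod (a * b) ^ 2 * weight (m - 1) / weight m"
    using prob[of True] by (simp add: cmod_amplitude weight_1)
  show "\<forall>\<beta>\<in>set_pmf Q. same_up_to_phase (snd \<beta>) (eta a b (fst \<beta>))"
  proof
    fix \<beta> assume "\<beta> \<in> set_pmf Q"
    then obtain s t where st: "(s, t) \<in> set_pmf ?O"
      and \<beta>: "\<beta> = (if t then m - 1 else m + 1, corrected \<psi> (eta a b 1) (s, t))"
      unfolding Q by auto
    \<comment> \<open>An outcome in the support has positive probability.\<close>
    have "amplitude m 1 t \<noteq> 0"
      using st pO[of s t] by (auto simp: set_pmf_iff)
    from same_up_to_phase_corrected[OF assms(1) c(1) this, of s]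
    show "same_up_to_phase (snd \<beta>) (eta a b (fst \<beta>))"
      by (simp add: \<beta> c(2))
  qed
qed

section \<open>One step of the chain\<close>

text \<open>Total probability over the index before the swap: \<open>k\<close> is reached upwards
  from \<open>k - 1\<close> or downwards from \<open>k + 1\<close>. For \<open>k = 0\<close> the
  truncated \<open>k - 1\<close> is 0, and that summand vanishes since all indices in
  \<open>A\<close> are positive.\<close>

lemma prob_swap_step:
  fixes A :: "labelled_state pmf"
  assumes A: "\<And>\<alpha>. \<alpha> \<in> set_pmf A \<Longrightarrow> 1 \<le> fst \<alpha> \<and> same_up_to_phase (snd \<alpha>) (eta a b (fst \<alpha>))"
  defines "B \<equiv> bind_pmf A (\<lambda>\<alpha>. entanglement_swap \<alpha> (1, eta a b 1))"
    and "P \<equiv> \<lambda>k. measure_pmf.prob A {\<alpha>. fst \<alpha> = k}"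
  shows "measure_pmf.prob B {\<beta>. fst \<beta> = k}
    = P (k - 1) * (weight k / weight (k - 1)) + P (k + 1) * (cmod (a * b) ^ 2 * weight k / weight (k + 1))"
proof -
  let ?u = "weight k / weight (k - 1)" and ?v = "cmod (a * b) ^ 2 * weight k / weight (k + 1)"
  have pointwise: "measure_pmf.prob (entanglement_swap \<alpha> (1, eta a b 1)) {\<beta>. fst \<beta> = k}
      = indicat_real {\<alpha>. fst \<alpha> = k - 1} \<alpha> * ?u + indicat_real {\<alpha>. fst \<alpha> = k + 1} \<alpha> * ?v"
    if "\<alpha> \<in> set_pmf A" for \<alpha>
  proof -
    obtain m \<psi> where \<alpha>: "\<alpha> = (m, \<psi>)" by (cases \<alpha>)
    with A[OF that] have m: "1 \<le> m" "same_up_to_phase \<psi> (eta a b m)" by auto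
    consider "k = m + 1" | "k = m - 1" | "k \<noteq> m + 1" "k \<noteq> m - 1" by blast
    then show ?thesis
    proof cases
      case 1
      with prob_swap_add[OF m] show ?thesis by (simp add: \<alpha>)
    next
      case 2
      with prob_swap_diff[OF m] m(1) show ?thesis by (simp add: \<alpha>)
    next
      case 3
      with fst_entanglement_swap[of _ "(m, \<psi>)"] m(1)
      have "measure_pmf.prob (entanglement_swap (m, \<psi>) (1, eta a b 1)) {\<beta>. fst \<beta> = k} = 0"
        by (fastforce simp: measure_pmf_zero_iff)
      with 3 m(1) show ?thesis by (auto simp: \<alpha> indicator_def)
    qed
  qed
  have "measure_pmf.prob B {\<beta>. fst \<beta> = k}
      = (\<integral>\<alpha>. measure_pmf.prob (entanglement_swap \<alpha> (1, eta a b 1)) {\<beta>. fst \<beta> = k} \<partial>measure_pmf A)"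
    unfolding B_def by (rule measure_bind_pmf)
  also have "\<dots> = (\<integral>\<alpha>. indicat_real {\<alpha>. fst \<alpha> = k - 1} \<alpha> * ?u
      + indicat_real {\<alpha>. fst \<alpha> = k + 1} \<alpha> * ?v \<partial>measure_pmf A)"
    by (intro integral_cong_AE AE_pmfI pointwise) simp_all
  also have "\<dots> = P (k - 1) * ?u + P (k + 1) * ?v"
    unfolding P_def
    by (subst Bochner_Integration.integral_add;
        (intro Bochner_Integration.integrable_mult_left integrable_real_indicator)?)
       (simp_all add: measure_pmf.emeasure_finite top.not_eq_extremum[symmetric])
  finally show ?thesis .
qed

lemma same_up_to_phase_swap_step:
  assumes A: "\<And>\<alpha>. \<alpha> \<in> set_pmf A \<Longrightarrow> 1 \<le> fst \<alpha> \<and> same_up_to_phase (snd \<alpha>) (eta a b (fst \<alpha>))"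
    and "\<beta> \<in> set_pmf (bind_pmf A (\<lambda>\<alpha>. entanglement_swap \<alpha> (1, eta a b 1)))"
  shows "same_up_to_phase (snd \<beta>) (eta a b (fst \<beta>))"
  using assms(2) set_pmf_swap A by fastforce

text \<open>Pulls out the common power with exponent \<open>2 * n\<close>. It is used with
  \<open>r = x\<close> for the hypothesis and with \<open>r = x + 1\<close> for the
  conclusion.\<close>

lemma weight_binomial_term:
  assumes "2 * n \<le> r"
  shows "cmod a ^ (2 * r - 2 * n) * cmod b ^ (2 * n) + cmod a ^ (2 * n) * cmod b ^ (2 * r - 2 * n)
    = cmod (a * b) ^ (2 * n) * weight (r - 2 * n)"
proof -
  obtain d where d: "r = 2 * n + d"
    using assms le_Suc_ex by blast
  then have "2 * r - 2 * n = 2 * n + 2 * d" by simp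
  with d show ?thesis
    by (simp add: weight_def norm_mult power_mult_distrib power_add algebra_simps)
qed

lemma swap_chain_step:
  assumes "odd x"
    and hyp: "\<And>n. n \<le> (x - 1) div 2 \<Longrightarrow>
      has_prob a b (swap_chain a b (x - 1)) (x - 2 * n)
        (real (x choose n) * cmod a ^ (2 * x - 2 * n) * cmod b ^ (2 * n)
         + real (x choose (x - n)) * cmod a ^ (2 * n) * cmod b ^ (2 * x - 2 * n))"
  shows "(\<forall>n < (x + 1) div 2.
      has_prob a b (swap_chain a b x) (x + 1 - 2 * n)
        (real ((x + 1) choose n) *
          (cmod a ^ (2 * (x + 1) - 2 * n) * cmod b ^ (2 * n)
           + cmod a ^ (2 * n) * cmod b ^ (2 * (x + 1) - 2 * n))))
    \<and> has_prob a b (swap_chain a b x) 0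
        (real ((x + 1) choose ((x + 1) div 2)) * cmod a ^ (x + 1) * cmod b ^ (x + 1))"
proof -
  obtain h where x: "x = 2 * h + 1"
    using assms(1) by (elim oddE)
  define A where "A = swap_chain a b (x - 1)"
  define P where "P k = measure_pmf.prob A {\<alpha>. fst \<alpha> = k}" for k
  have chain: "swap_chain a b x = bind_pmf A (\<lambda>\<alpha>. entanglement_swap \<alpha> (1, eta a b 1))"
    by (simp add: x A_def)
  have index: "fst \<alpha> \<le> x" "odd (fst \<alpha>)" if "\<alpha> \<in> set_pmf A" for \<alpha>
    using swap_chain_index[of \<alpha> a b "x - 1"] that by (auto simp: A_def x)
  have A: "1 \<le> fst \<alpha> \<and> same_up_to_phase (snd \<alpha>) (eta a b (fst \<alpha>))" if \<alpha>: "\<alpha> \<in> set_pmf A" for \<alpha>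
  proof -
    \<comment> \<open>An odd index up to \<open>x\<close> has the form \<open>x - 2 * n\<close> with
      \<open>n = h - j\<close>, so the hypothesis covers the whole support.\<close>
    obtain j where j: "fst \<alpha> = 2 * j + 1"
      using index(2)[OF \<alpha>] by (elim oddE)
    with index(1)[OF \<alpha>] have "fst \<alpha> = x - 2 * (h - j)" "h - j \<le> (x - 1) div 2"
      by (auto simp: x)
    with hyp[of "h - j"] \<alpha> j show ?thesis
      unfolding has_prob_def A_def by auto
  qed
  \<comment> \<open>Boundary values for the recursion at \<open>k = 0\<close> and
    \<open>k = x + 1\<close>: index 0 has the wrong parity, and \<open>x + 2\<close> is out of
    range.\<close>
  have P0: "P 0 = 0" and P_top: "P (x + 2) = 0"
    using index by (force simp: P_def measure_pmf_zero_iff)+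
  have P: "P (x - 2 * n) = real (x choose n) * cmod (a * b) ^ (2 * n) * weight (x - 2 * n)" if "n \<le> h" for n
  proof -
    have "2 * n \<le> x" and "x choose (x - n) = x choose n"
      using that binomial_symmetric[of n x] by (auto simp: x)
    with hyp[of n] that weight_binomial_term[of n x, symmetric] show ?thesis
      unfolding has_prob_def by (simp add: P_def A_def x algebra_simps)
  qed
  have step: "measure_pmf.prob (swap_chain a b x) {\<beta>. fst \<beta> = k}
      = P (k - 1) * (weight k / weight (k - 1)) + P (k + 1) * (cmod (a * b) ^ 2 * weight k / weight (k + 1))"
    for k
    unfolding chain P_def by (rule prob_swap_step) (rule A)
  have phase: "\<forall>\<beta>\<in>set_pmf (swap_chain a b x). fst \<beta> = k \<longrightarrow> same_up_to_phase (snd \<beta>) (eta a b k)" for k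
    using same_up_to_phase_swap_step[OF A] unfolding chain by blast
  have w: "weight k \<noteq> 0" for k
    using weight_pos[of k] by simp
  have prob_pos: "measure_pmf.prob (swap_chain a b x) {\<beta>. fst \<beta> = x + 1 - 2 * n}
      = real ((x + 1) choose n) * (cmod (a * b) ^ (2 * n) * weight (x + 1 - 2 * n))"
    if "n < (x + 1) div 2" for n
  proof (cases n)
    case 0
    show ?thesis
      using P[of 0] P_top w[of x] step[of "x + 1"] by (simp add: 0)
  next
    case (Suc j)
    \<comment> \<open>The step up keeps the exponent \<open>2 * n\<close>; the step down turns
      \<open>2 * j\<close> into \<open>2 * n\<close> by its factor \<open>cmod (a * b) ^ 2\<close>.
      Pascal's rule adds the two coefficients.\<close>
    have n: "n \<le> h" and idx: "x + 1 - 2 * n - 1 = x - 2 * n" "x + 1 - 2 * n + 1 = x - 2 * j"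
      using that by (auto simp: x Suc)
    have "P (x - 2 * n) * (weight (x + 1 - 2 * n) / weight (x - 2 * n))
        = real (x choose n) * cmod (a * b) ^ (2 * n) * weight (x + 1 - 2 * n)"
      using P[OF n] w by simp
    moreover have "P (x - 2 * j) * (cmod (a * b) ^ 2 * weight (x + 1 - 2 * n) / weight (x - 2 * j))
        = real (x choose j) * cmod (a * b) ^ (2 * n) * weight (x + 1 - 2 * n)"
      using P[of j] n w by (simp add: Suc power_add power2_eq_square)
    ultimately show ?thesis
      unfolding step idx by (simp add: Suc algebra_simps)
  qed
  have prob_0: "measure_pmf.prob (swap_chain a b x) {\<beta>. fst \<beta> = 0}
      = real ((x + 1) choose ((x + 1) div 2)) * cmod a ^ (x + 1) * cmod b ^ (x + 1)"
  proof -
    \<comment> \<open>Pascal's rule at the centre, where the two binomials are equal by symmetry.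
      The 2 matches \<open>weight 0 = 2\<close>.\<close>
    have choose: "(x + 1) choose ((x + 1) div 2) = 2 * (x choose h)"
      using binomial_symmetric[of h x] by (simp add: x)
    have P1: "P 1 = real (x choose h) * cmod (a * b) ^ (2 * h) * weight 1"
      using P[of h] by (simp add: x)
    have "weight 0 = 2"
      by (simp add: weight_def)
    then have "measure_pmf.prob (swap_chain a b x) {\<beta>. fst \<beta> = 0} = P 1 * (cmod (a * b) ^ 2 * 2 / weight 1)"
      using step[of 0] P0 by simp
    also have "\<dots> = 2 * real (x choose h) * cmod (a * b) ^ (2 * h + 2)"
      unfolding P1 power_add using w[of 1] by (simp add: field_simps)
    also have "2 * h + 2 = x + 1"
      by (simp add: x)
    finally show ?thesis
      unfolding choose norm_mult power_mult_distrib by simp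
  qed
  have "has_prob a b (swap_chain a b x) (x + 1 - 2 * n)
      (real ((x + 1) choose n) *
        (cmod a ^ (2 * (x + 1) - 2 * n) * cmod b ^ (2 * n)
         + cmod a ^ (2 * n) * cmod b ^ (2 * (x + 1) - 2 * n)))"
    if "n < (x + 1) div 2" for n
  proof -
    have "2 * n \<le> x + 1"
      using that by linarith
    from prob_pos[OF that] phase show ?thesis
      unfolding has_prob_def weight_binomial_term[OF \<open>2 * n \<le> x + 1\<close>] by blast
  qed
  moreover have "has_prob a b (swap_chain a b x) 0
      (real ((x + 1) choose ((x + 1) div 2)) * cmod a ^ (x + 1) * cmod b ^ (x + 1))"
    using prob_0 phase unfolding has_prob_def by blast
  ultimately show ?thesis by blast
qed

end

theorem theorem1:
  fixes a b :: complex and x :: nat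
  assumes "(cmod a)\<^sup>2 + (cmod b)\<^sup>2 = 1"
    and "x \<ge> 1" and "odd x"
    and "\<And>n. n \<le> (x - 1) div 2 \<Longrightarrow>
      has_prob a b (swap_chain a b (x - 1)) (x - 2 * n)
        (real (x choose n) * cmod a ^ (2 * x - 2 * n) * cmod b ^ (2 * n)
         + real (x choose (x - n)) * cmod a ^ (2 * n) * cmod b ^ (2 * x - 2 * n))"
  shows "(\<forall>n < (x + 1) div 2.
      has_prob a b (swap_chain a b x) (x + 1 - 2 * n)
        (real ((x + 1) choose n) *
          (cmod a ^ (2 * (x + 1) - 2 * n) * cmod b ^ (2 * n)
           + cmod a ^ (2 * n) * cmod b ^ (2 * (x + 1) - 2 * n))))
    \<and> has_prob a b (swap_chain a b x) 0
        (real ((x + 1) choose ((x + 1) div 2)) * cmod a ^ (x + 1) * cmod b ^ (x + 1))"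
  using swap_chain_step[OF assms(1,3,4)] .

end
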